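(* Let $0<\varepsilon\le 1$ be a real number and let $r\ge 2$ and $d\ge 1$ be integers. For a positive integer $m$, say that property $(\ast)_m$ holds if there is an integer $N_0$ (depending on $\varepsilon,r,d,m$) such that for every finite set $X\subset\mathbb{R}^d$ with $|X|\ge N_0$ there exist $m$ partitions $\mathcal{P}_1,\ldots,\mathcal{P}_m$ of $X$, each into $r$ parts, with the following property: for every subset $Y\subset X$ with $|Y|\ge\varepsilon|X|$ there is an index $k\in\{1,\ldots,m\}$ such that $\mathcal{P}_k(Y)$ is a Tverberg partition of $Y$. Then the smallest positive integer $m$ for which $(\ast)_m$ holds is \[ m(\varepsilon,r)=\left\lfloor \frac{\ln\left(\frac{1}{\varepsilon}\right)}{\ln\left(\frac{r}{r-1}\right)}\right\rfloor+1 . \] Equivalently, $(\ast)_m$ holds if and only if $\varepsilon>\left(\frac{r-1}{r}\right)^m$.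
   Context: For a partition $\mathcal{P}$ of a set $X$ into $r$ sets and $Y\subset X$, the restriction is $\mathcal{P}(Y)=\{K\cap Y: K\in\mathcal{P}\}$, a partition of $Y$ into $r$ sets, some possibly empty. A partition of a finite set $Y\subset\mathbb{R}^d$ into $r$ sets $Y_1,\ldots,Y_r$ is a Tverberg partition if $\bigcap_{j=1}^r \operatorname{conv}(Y_j)\neq\emptyset$ (in particular no part is empty). *)

theory Defs
  imports "HOL-Analysis.Analysis" "HOL-Library.Disjoint_Sets"
begin

definition partition_into :: "nat \<Rightarrow> 'a set \<Rightarrow> 'a set set \<Rightarrow> bool" where
  "partition_into r X P \<longleftrightarrow> partition_on X P \<and> finite P \<and> card P = r"

text \<open>The parts of a restriction may be empty. Several empty parts are identified in the set below;
  this is harmless, because a family with an empty part is never a Tverberg partition.\<close>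

definition restrict_partition :: "'a set set \<Rightarrow> 'a set \<Rightarrow> 'a set set" where
  "restrict_partition P Y = {K \<inter> Y | K. K \<in> P}"

definition Tverberg_partition :: "nat \<Rightarrow> 'a::real_vector set \<Rightarrow> 'a set set \<Rightarrow> bool" where
  "Tverberg_partition r Y Q \<longleftrightarrow>
     finite Y \<and> partition_into r Y Q \<and> (\<Inter>K\<in>Q. convex hull K) \<noteq> {}"

text \<open>The type argument carries the dimension: the ambient space is \<open>real ^ 'd\<close>, of dimension
  \<open>CARD('d) \<ge> 1\<close>. The partitions need not be pairwise distinct.\<close>

definition tolerant_property :: "'d::finite itself \<Rightarrow> real \<Rightarrow> nat \<Rightarrow> nat \<Rightarrow> bool" where
  "tolerant_property (_ :: 'd itself) \<epsilon> r m \<longleftrightarrow>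
     (\<exists>N0::nat. \<forall>X :: (real ^ 'd) set. finite X \<and> N0 \<le> card X \<longrightarrow>
        (\<exists>P :: nat \<Rightarrow> (real ^ 'd) set set.
           (\<forall>k\<in>{1..m}. partition_into r X (P k)) \<and>
           (\<forall>Y\<subseteq>X. \<epsilon> * real (card X) \<le> real (card Y) \<longrightarrow>
              (\<exists>k\<in>{1..m}. Tverberg_partition r Y (restrict_partition (P k) Y)))))"

end

theory Submission
  imports Defs "HOL-Real_Asymp.Real_Asymp"
begin

text \<open>Necessity: deleting, for each of the \<open>m\<close> partitions in turn, the part that is smallest on what
  remains keeps a fraction of at least \<open>((r - 1) / r) ^ m\<close> of the points and empties a part of
  every partition.

  Sufficiency: colour each point independently and uniformly with an element of \<open>[r]^m\<close>. If every
  partition fails on \<open>Y\<close>, separation gives halfspaces \<open>H k j\<close> with \<open>\<Inter>j. H k j = {}\<close> for each \<open>k\<close>, such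
  that every point of \<open>Y\<close> of colour \<open>c\<close> lies in all \<open>H k (c k)\<close>. For fixed halfspaces a random
  colour of a point has this property with probability at most \<open>((r - 1) / r) ^ m < \<epsilon>\<close>, so by a
  Chernoff bound \<open>|Y| \<ge> \<epsilon> |X|\<close> is exponentially unlikely, whereas the halfspaces have only
  polynomially many traces on \<open>X\<close>, since by Radon's theorem they shatter no set of more than
  \<open>d + 1\<close> points.\<close>

section \<open>Closed halfspaces and the separation of several convex sets\<close>

text \<open>The normal \<open>a\<close> may be 0, so the empty set and the whole space are members.
  The empty set is the halfspace that encloses an empty convex hull in the separation below.\<close>

definition closed_halfspaces :: "'a::real_inner set set" where
  "closed_halfspaces = {{x. a \<bullet> x \<le> b} | a b. True}"

lemma closed_halfspaceI: "{x. a \<bullet> x \<le> b} \<in> closed_halfspaces"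
  unfolding closed_halfspaces_def by blast

lemma closed_halfspaces_props:
  assumes "H \<in> closed_halfspaces"
  shows "closed H" "convex H" "convex (- H)"
proof -
  obtain a b where H: "H = {x. a \<bullet> x \<le> b}"
    using assms unfolding closed_halfspaces_def by blast
  have "- H = {x. a \<bullet> x > b}"
    unfolding H by auto
  then show "closed H" "convex H" "convex (- H)"
    unfolding H by (simp_all add: closed_halfspace_le convex_halfspace_le convex_halfspace_gt)
qed

text \<open>Induction on \<open>J\<close>, with the extra closed convex set \<open>S\<close> as the
  generalisation that carries it; the application takes \<open>S = UNIV\<close>. First
  \<open>C i\<close> is absorbed into \<open>S\<close>, and the induction hypothesis encloses the
  other sets in halfspaces. Then \<open>S\<close> together with these halfspaces forms a closed
  convex set \<open>D\<close> disjoint from the compact set \<open>C i\<close>, and strict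
  separation of the two supplies the halfspace for \<open>C i\<close>.\<close>

lemma closed_halfspaces_empty_Inter:
  fixes C :: "'i \<Rightarrow> 'a::euclidean_space set"
  assumes "finite J" "\<And>j. j \<in> J \<Longrightarrow> compact (C j) \<and> convex (C j)"
    and "closed S" "convex S" "S \<inter> (\<Inter>j\<in>J. C j) = {}"
  shows "\<exists>H. (\<forall>j\<in>J. H j \<in> closed_halfspaces \<and> C j \<subseteq> H j) \<and> S \<inter> (\<Inter>j\<in>J. H j) = {}"
  using assms
proof (induction J arbitrary: S rule: finite_induct)
  case empty
  then show ?case by auto
next
  case (insert i J)
  have C: "compact (C i)" "convex (C i)"
    using insert.prems(1) by auto
  have "closed (S \<inter> C i)" "convex (S \<inter> C i)"
    using C insert.prems by (auto intro: compact_imp_closed convex_Int)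
  moreover have "(S \<inter> C i) \<inter> (\<Inter>j\<in>J. C j) = {}"
    using insert.prems(4) by auto
  ultimately obtain H where H: "\<forall>j\<in>J. H j \<in> closed_halfspaces \<and> C j \<subseteq> H j"
    "(S \<inter> C i) \<inter> (\<Inter>j\<in>J. H j) = {}"
    using insert.IH[of "S \<inter> C i"] insert.prems(1) by blast
  define D where "D = S \<inter> (\<Inter>j\<in>J. H j)"
  have D: "closed D" "convex D"
    unfolding D_def using H(1) insert.prems(2,3)
    by (simp_all add: closed_halfspaces_props closed_INT convex_INT closed_Int convex_Int)
  have "\<exists>G\<in>closed_halfspaces. C i \<subseteq> G \<and> D \<inter> G = {}"
  proof (cases "C i = {}")
    case True
    have "{x. (0::'a) \<bullet> x \<le> -1} = {}" by auto
    then show ?thesis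
      using True closed_halfspaceI[of "0::'a" "-1"] by auto
  next
    case False
    have "C i \<inter> D = {}"
      using H(2) unfolding D_def by auto
    then obtain a b where "\<forall>x\<in>C i. a \<bullet> x < b" "\<forall>x\<in>D. a \<bullet> x > b"
      using separating_hyperplane_compact_closed[OF C(2,1) False D(2,1)] by auto
    then have "C i \<subseteq> {x. a \<bullet> x \<le> b} \<and> D \<inter> {x. a \<bullet> x \<le> b} = {}"
      by fastforce
    then show ?thesis
      using closed_halfspaceI by blast
  qed
  then obtain G where G: "G \<in> closed_halfspaces" "C i \<subseteq> G" "D \<inter> G = {}"
    by blast
  have "(\<Inter>j\<in>J. (H(i := G)) j) = (\<Inter>j\<in>J. H j)"
    using insert.hyps by (intro INF_cong) auto
  then have "S \<inter> (\<Inter>j\<in>insert i J. (H(i := G)) j) = D \<inter> G"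
    unfolding D_def INF_insert by auto
  then show ?case
    using G H(1) by (intro exI[of _ "H(i := G)"]) auto
qed

section \<open>Shattering and the number of halfspace traces\<close>

definition shatters :: "'a set set \<Rightarrow> 'a set \<Rightarrow> bool" where
  "shatters F S \<longleftrightarrow> (\<forall>T\<subseteq>S. \<exists>A\<in>F. A \<inter> S = T)"

text \<open>Pajor's form of the Sauer--Shelah lemma.\<close>

lemma card_le_card_shattered:
  assumes "finite X" "F \<subseteq> Pow X"
  shows "card F \<le> card {S. S \<subseteq> X \<and> shatters F S}"
  using assms
proof (induction X arbitrary: F rule: finite_induct)
  case empty
  show ?case
  proof (cases "F = {}")
    case False
    with empty have "F = {{}}" by auto
    then have "{S. S \<subseteq> {} \<and> shatters F S} = {{}}"
      by (auto simp: shatters_def)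
    then show ?thesis
      using \<open>F = {{}}\<close> by simp
  qed simp
next
  case (insert x X)
  \<comment> \<open>The family is split by whether a member contains \<open>x\<close>, with
    \<open>x\<close> removed in \<open>F1\<close>. A set shattered by \<open>F0\<close> or by
    \<open>F1\<close> is shattered by \<open>F\<close>; if both shatter \<open>S\<close>, then
    \<open>F\<close> shatters \<open>insert x S\<close> as well. The sets in the intersection of
    \<open>Sh F0\<close> and \<open>Sh F1\<close> thus count twice, which matches
    \<open>card (Sh F0) + card (Sh F1)\<close>.\<close>
  define F0 where "F0 = F \<inter> Pow X"
  define F1 where "F1 = {A. A \<subseteq> X \<and> insert x A \<in> F}"
  define Sh where "Sh G = {S. S \<subseteq> X \<and> shatters G S}" for G
  have ShD: "\<exists>A\<in>G. A \<inter> S = T" if "S \<in> Sh G" "T \<subseteq> S" for G S T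
    using that by (simp add: Sh_def shatters_def)
  have F1_eq: "insert x ` F1 = F - F0"
  proof
    show "insert x ` F1 \<subseteq> F - F0"
      using insert.hyps unfolding F0_def F1_def by auto
    show "F - F0 \<subseteq> insert x ` F1"
    proof
      fix A assume A: "A \<in> F - F0"
      then have "x \<in> A" "A - {x} \<subseteq> X"
        using insert.prems unfolding F0_def by auto
      then have "A = insert x (A - {x})" "A - {x} \<in> F1"
        using A unfolding F1_def by (auto simp: insert_absorb)
      then show "A \<in> insert x ` F1" by blast
    qed
  qed
  have finF: "finite F"
    using insert.prems insert.hyps by (meson finite_Pow_iff finite_insert finite_subset)
  have inj: "inj_on (insert x) (Pow X)"
    using insert.hyps unfolding inj_on_def by (metis PowD insert_ident subsetD)
  then have "inj_on (insert x) F1"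
    by (rule inj_on_subset) (auto simp: F1_def)
  then have "card F = card F0 + card F1"
    using F1_eq finF card_image[of "insert x" F1]
    by (metis F0_def Int_lower1 card_Diff_subset card_mono finite_Int le_add_diff_inverse)
  also have "\<dots> \<le> card (Sh F0) + card (Sh F1)"
    unfolding Sh_def by (intro add_mono insert.IH) (auto simp: F0_def F1_def)
  also have "\<dots> = card (Sh F0 \<union> Sh F1) + card (Sh F0 \<inter> Sh F1)"
    by (rule card_Un_Int) (use insert.hyps in \<open>auto simp: Sh_def\<close>)
  also have "card (Sh F0 \<inter> Sh F1) = card (insert x ` (Sh F0 \<inter> Sh F1))"
    by (intro card_image[symmetric] inj_on_subset[OF inj]) (auto simp: Sh_def)
  also have "card (Sh F0 \<union> Sh F1) + \<dots> = card ((Sh F0 \<union> Sh F1) \<union> insert x ` (Sh F0 \<inter> Sh F1))"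
    by (rule card_Un_disjoint[symmetric]) (use insert.hyps in \<open>auto simp: Sh_def\<close>)
  also have "\<dots> \<le> card {S. S \<subseteq> insert x X \<and> shatters F S}"
  proof (rule card_mono)
    show "finite {S. S \<subseteq> insert x X \<and> shatters F S}"
      using insert.hyps by auto
    have "shatters F S" if "S \<in> Sh F0" for S
      using that unfolding Sh_def F0_def shatters_def by blast
    moreover have "shatters F S" if S: "S \<in> Sh F1" for S
      unfolding shatters_def
    proof (intro allI impI)
      fix T assume "T \<subseteq> S"
      then obtain A where "A \<in> F1" "A \<inter> S = T"
        using ShD[OF S] by auto
      then show "\<exists>A\<in>F. A \<inter> S = T"
        using S insert.hyps unfolding Sh_def F1_def by (intro bexI[of _ "insert x A"]) auto
    qed
    moreover have "shatters F (insert x S)" if S: "S \<in> Sh F0 \<inter> Sh F1" for S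
      unfolding shatters_def
    proof (intro allI impI)
      fix T assume T: "T \<subseteq> insert x S"
      then have T': "T - {x} \<subseteq> S" by auto
      show "\<exists>A\<in>F. A \<inter> insert x S = T"
      proof (cases "x \<in> T")
        case True
        obtain A where "A \<in> F1" "A \<inter> S = T - {x}"
          using ShD[of S F1, OF _ T'] S by auto
        then show ?thesis
          using True unfolding F1_def by (intro bexI[of _ "insert x A"]) auto
      next
        case False
        obtain A where "A \<in> F0" "A \<inter> S = T - {x}"
          using ShD[of S F0, OF _ T'] S by auto
        then show ?thesis
          using False insert.hyps unfolding F0_def by (intro bexI[of _ A]) auto
      qed
    qed
    ultimately show "Sh F0 \<union> Sh F1 \<union> insert x ` (Sh F0 \<inter> Sh F1)
        \<subseteq> {S. S \<subseteq> insert x X \<and> shatters F S}"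
      by (auto simp: Sh_def)
  qed
  finally show ?case .
qed

text \<open>A larger set would have a Radon partition into \<open>M\<close> and \<open>P\<close>
  with intersecting hulls. A halfspace whose trace on \<open>S\<close> is \<open>M\<close> has
  \<open>P\<close> in its complement; both being convex, they would separate the two hulls.\<close>

lemma card_shattered_by_halfspaces_le:
  fixes S :: "'a::euclidean_space set"
  assumes "finite S" "S \<subseteq> X" "shatters ((\<inter>) X ` closed_halfspaces) S"
  shows "card S \<le> DIM('a) + 1"
proof (rule ccontr)
  assume "\<not> card S \<le> DIM('a) + 1"
  then have "affine_dependent S"
    using affine_dependent_biggerset[OF assms(1)] by simp
  then obtain M P where MP: "M \<subseteq> S" "P \<subseteq> S" "M \<inter> P = {}" "convex hull M \<inter> convex hull P \<noteq> {}"
    by (rule Radon)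
  obtain H where H: "H \<in> closed_halfspaces" "X \<inter> H \<inter> S = M"
    using assms(3) MP(1) unfolding shatters_def by (metis (no_types, lifting) imageE)
  have "M \<subseteq> H" "P \<subseteq> - H"
    using H(2) MP(2,3) assms(2) by auto
  then have "convex hull M \<subseteq> H" "convex hull P \<subseteq> - H"
    using closed_halfspaces_props[OF H(1)] by (simp_all add: hull_minimal)
  then show False
    using MP(4) by auto
qed

text \<open>A crude bound suffices: for fixed \<open>k\<close> only polynomial growth in
  \<open>card X\<close> matters, since it is later set against exponential decay.\<close>

lemma card_small_subsets_le:
  assumes "finite X"
  shows "card {S. S \<subseteq> X \<and> card S \<le> k} \<le> (k + 1) * (card X + 1) ^ k"
proof -
  have "{S. S \<subseteq> X \<and> card S \<le> k} = (\<Union>i\<le>k. {S. S \<subseteq> X \<and> card S = i})"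
    by auto
  then have "card {S. S \<subseteq> X \<and> card S \<le> k} \<le> (\<Sum>i\<le>k. card {S. S \<subseteq> X \<and> card S = i})"
    using card_UN_le[of "{..k}"] by simp
  also have "\<dots> = (\<Sum>i\<le>k. card X choose i)"
    by (simp add: n_subsets[OF assms])
  also have "\<dots> \<le> (\<Sum>i\<le>k. (card X + 1) ^ k)"
  proof (rule sum_mono)
    fix i assume i: "i \<in> {..k}"
    have "card X choose i \<le> card X ^ i"
      by (cases "i \<le> card X") (auto simp: binomial_le_pow binomial_eq_0)
    also have "\<dots> \<le> (card X + 1) ^ i"
      by (simp add: power_mono)
    also have "\<dots> \<le> (card X + 1) ^ k"
      using i by (intro power_increasing) auto
    finally show "card X choose i \<le> (card X + 1) ^ k" .
  qed
  finally show ?thesis by simp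
qed

lemma card_halfspace_traces_le:
  fixes X :: "'a::euclidean_space set"
  assumes "finite X"
  shows "card ((\<inter>) X ` closed_halfspaces) \<le> (DIM('a) + 2) * (card X + 1) ^ (DIM('a) + 1)"
proof -
  let ?F = "(\<inter>) X ` closed_halfspaces"
  have "card ?F \<le> card {S. S \<subseteq> X \<and> shatters ?F S}"
    using assms by (intro card_le_card_shattered) auto
  also have "\<dots> \<le> card {S. S \<subseteq> X \<and> card S \<le> DIM('a) + 1}"
    using assms card_shattered_by_halfspaces_le[OF finite_subset[OF _ assms]]
    by (intro card_mono) auto
  also have "\<dots> \<le> (DIM('a) + 2) * (card X + 1) ^ (DIM('a) + 1)"
    using card_small_subsets_le[OF assms, of "DIM('a) + 1"] by simp
  finally show ?thesis .
qed

section \<open>A Chernoff bound in counting form\<close>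

text \<open>The exponential moment method for a uniformly random \<open>f\<close>, with
  probabilities multiplied by the number of functions. Each \<open>f\<close> is weighted by
  \<open>t\<close> to the number of points \<open>x\<close> with \<open>f x\<close> in
  \<open>A x\<close>; functions with at least \<open>s\<close> such points have weight at least
  \<open>t powr s\<close>, as \<open>t\<close> is at least 1.\<close>

lemma chernoff_count:
  fixes t p s :: real
  assumes "finite X" "finite C" "1 \<le> t"
    and "\<And>x. x \<in> X \<Longrightarrow> A x \<subseteq> C" "\<And>x. x \<in> X \<Longrightarrow> real (card (A x)) \<le> p * real (card C)"
  shows "real (card {f \<in> X \<rightarrow>\<^sub>E C. s \<le> real (card {x\<in>X. f x \<in> A x})}) * t powr s
     \<le> (real (card C) * (1 + p * (t - 1))) ^ card X"
proof -
  let ?B = "{f \<in> X \<rightarrow>\<^sub>E C. s \<le> real (card {x\<in>X. f x \<in> A x})}"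
  let ?w = "\<lambda>x c. if c \<in> A x then t else 1"
  have fin: "finite (X \<rightarrow>\<^sub>E C)"
    using assms(1,2) by (simp add: finite_PiE)
  have w: "(\<Prod>x\<in>X. ?w x (f x)) = t ^ card {x\<in>X. f x \<in> A x}" for f
    using assms(1) by (simp add: prod.If_cases Int_def)
  have "real (card ?B) * t powr s = (\<Sum>f\<in>?B. t powr s)"
    by simp
  also have "\<dots> \<le> (\<Sum>f\<in>?B. \<Prod>x\<in>X. ?w x (f x))"
  proof (rule sum_mono)
    fix f assume "f \<in> ?B"
    then have "t powr s \<le> t powr real (card {x\<in>X. f x \<in> A x})"
      using assms(3) by (intro powr_mono) auto
    then show "t powr s \<le> (\<Prod>x\<in>X. ?w x (f x))"
      unfolding w using assms(3) by (simp add: powr_realpow)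
  qed
  also have "\<dots> \<le> (\<Sum>f\<in>X \<rightarrow>\<^sub>E C. \<Prod>x\<in>X. ?w x (f x))"
    using assms(3) fin by (intro sum_mono2) (auto intro!: prod_nonneg)
  \<comment> \<open>This exchange of sum and product expresses the independence of the values of
    \<open>f\<close> at different points.\<close>
  also have "\<dots> = (\<Prod>x\<in>X. \<Sum>c\<in>C. ?w x c)"
    using assms(1,2) by (simp add: prod_sum_PiE)
  also have "\<dots> \<le> (\<Prod>x\<in>X. real (card C) * (1 + p * (t - 1)))"
  proof (rule prod_mono)
    fix x assume x: "x \<in> X"
    have "(\<Sum>c\<in>C. ?w x c) = (\<Sum>c\<in>C. 1 + (t - 1) * (if c \<in> A x then 1 else 0))"
      by (intro sum.cong) auto
    also have "\<dots> = real (card C) + (t - 1) * real (card (A x))"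
      using assms(2) assms(4)[OF x]
      by (simp add: sum.distrib sum_distrib_left[symmetric] sum.If_cases Int_absorb1)
    also have "\<dots> \<le> real (card C) + (t - 1) * (p * real (card C))"
      using assms(3) assms(5)[OF x] by (intro add_left_mono mult_left_mono) auto
    finally show "0 \<le> (\<Sum>c\<in>C. ?w x c) \<and> (\<Sum>c\<in>C. ?w x c) \<le> real (card C) * (1 + p * (t - 1))"
      using assms(3) by (auto simp: algebra_simps intro!: sum_nonneg)
  qed
  also have "\<dots> = (real (card C) * (1 + p * (t - 1))) ^ card X"
    by simp
  finally show ?thesis .
qed

text \<open>At \<open>t = 1\<close> both sides equal 1, and the derivative of their difference there
  is \<open>e - p > 0\<close>, so any \<open>t\<close> slightly above 1 works.\<close>

lemma chernoff_base:
  fixes p e :: real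
  assumes "p < e"
  obtains t where "1 < t" "1 + p * (t - 1) < t powr e"
proof -
  let ?g = "\<lambda>t::real. t powr e - (1 + p * (t - 1))"
  have "(?g has_real_derivative e - p) (at 1)"
    by (auto intro!: derivative_eq_intros)
  then obtain d where d: "d > 0" "\<And>h. 0 < h \<Longrightarrow> h < d \<Longrightarrow> ?g 1 < ?g (1 + h)"
    using DERIV_pos_inc_right[of ?g "e - p" 1] assms by auto
  show ?thesis
    using d(2)[of "d / 2"] d(1) by (intro that[of "1 + d / 2"]) auto
qed


section \<open>Partitions from colourings, and the union bound for a random colouring\<close>

text \<open>As a set of sets this merges all empty colour classes, so it is a partition into
  \<open>r\<close> parts only when every colour below \<open>r\<close> occurs on
  \<open>X\<close>.\<close>

definition fibres :: "nat \<Rightarrow> ('a \<Rightarrow> nat) \<Rightarrow> 'a set \<Rightarrow> 'a set set" where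
  "fibres r g X = (\<lambda>j. {x\<in>X. g x = j}) ` {..<r}"

lemma partition_into_fibres:
  assumes "g ` X = {..<r}"
  shows "partition_into r X (fibres r g X)"
proof -
  have ne: "{x\<in>X. g x = j} \<noteq> {}" if "j < r" for j
  proof -
    have "j \<in> g ` X"
      using that assms by simp
    then show ?thesis by auto
  qed
  have "inj_on (\<lambda>j. {x\<in>X. g x = j}) {..<r}"
  proof (rule inj_onI)
    fix i j assume "i \<in> {..<r}" and eq: "{x\<in>X. g x = i} = {x\<in>X. g x = j}"
    then obtain x where "x \<in> {x\<in>X. g x = i}"
      using ne by blast
    then show "i = j"
      using eq by auto
  qed
  then have "card (fibres r g X) = r"
    unfolding fibres_def by (simp add: card_image)
  moreover have "partition_on X (fibres r g X)"
    unfolding partition_on_def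
  proof (intro conjI)
    show "\<Union> (fibres r g X) = X"
      using assms by (auto simp: fibres_def)
    show "disjoint (fibres r g X)"
      by (auto simp: fibres_def disjoint_def)
    show "{} \<notin> fibres r g X"
      using ne by (auto simp: fibres_def simp del: Collect_empty_eq)
  qed
  ultimately show ?thesis
    unfolding partition_into_def by (simp add: fibres_def)
qed

lemma restrict_partition_fibres:
  assumes "Y \<subseteq> X"
  shows "restrict_partition (fibres r g X) Y = fibres r g Y"
proof -
  have "{x\<in>X. g x = j} \<inter> Y = {x\<in>Y. g x = j}" for j
    using assms by auto
  then show ?thesis
    unfolding restrict_partition_def fibres_def Setcompr_eq_image image_image by simp
qed

text \<open>A union bound: each system \<open>T\<close> of members of \<open>F\<close> with empty
  intersections is violated by few colourings, by the Chernoff count, and there are at most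
  \<open>card F ^ (m * r)\<close> systems. The hypothesis \<open>small\<close> says that the bad
  colourings together do not exhaust all colourings, so one \<open>f\<close> is good for all systems
  at once.\<close>

lemma good_colouring_exists:
  fixes F :: "'a set set" and p t e :: real
  assumes "finite X" "finite F" "0 < r" "1 \<le> t"
    and p: "p = ((real r - 1) / real r) ^ m"
    and small: "real (card F ^ (m * r)) * (1 + p * (t - 1)) ^ card X < t powr (e * real (card X))"
  shows "\<exists>f\<in>X \<rightarrow>\<^sub>E ({1..m} \<rightarrow>\<^sub>E {..<r}).
    \<forall>T. (\<forall>k\<in>{1..m}. (\<forall>j<r. T k j \<in> F) \<and> (\<Inter>j<r. T k j) = {}) \<longrightarrow>
      real (card {x\<in>X. \<forall>k\<in>{1..m}. x \<in> T k (f x k)}) < e * real (card X)"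
proof -
  define C where "C = ({1..m} \<rightarrow>\<^sub>E {..<r})"
  define I where "I = {1..m} \<times> {..<r}"
  define V where "V = {T \<in> I \<rightarrow>\<^sub>E F. \<forall>k\<in>{1..m}. (\<Inter>j<r. T (k, j)) = {}}"
  define A where "A T x = {c\<in>C. \<forall>k\<in>{1..m}. x \<in> T (k, c k)}" for T :: "nat \<times> nat \<Rightarrow> 'a set" and x
  define B where "B T = {f \<in> X \<rightarrow>\<^sub>E C. e * real (card X) \<le> real (card {x\<in>X. f x \<in> A T x})}" for T
  have finC: "finite C" and cardC: "card C = r ^ m"
    unfolding C_def by (simp_all add: finite_PiE card_PiE)
  have "V \<subseteq> I \<rightarrow>\<^sub>E F" "finite (I \<rightarrow>\<^sub>E F)" "card (I \<rightarrow>\<^sub>E F) = card F ^ (m * r)"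
    unfolding V_def I_def using assms(2) by (auto simp: finite_PiE card_PiE)
  then have finV: "finite V" and cardV: "card V \<le> card F ^ (m * r)"
    by (metis finite_subset, metis card_mono)
  let ?M = "real (r ^ m)"
  have cardA: "real (card (A T x)) \<le> p * real (card C)" if T: "T \<in> V" for T x
  proof -
    \<comment> \<open>The colours admissible at \<open>x\<close> form a box. For each
      \<open>k\<close> the sets \<open>T (k, j)\<close> have no common point, so some
      \<open>j\<close> is excluded and every side of the box has at most \<open>r - 1\<close>
      elements.\<close>
    have "A T x = (\<Pi>\<^sub>E k\<in>{1..m}. {j. j < r \<and> x \<in> T (k, j)})"
      unfolding A_def C_def set_eq_iff by (simp add: PiE_iff) blast
    then have "card (A T x) = (\<Prod>k\<in>{1..m}. card {j. j < r \<and> x \<in> T (k, j)})"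
      by (simp add: card_PiE)
    also have "\<dots> \<le> (\<Prod>k\<in>{1..m}. r - 1)"
    proof (rule prod_mono)
      fix k assume "k \<in> {1..m}"
      then have "(\<Inter>j<r. T (k, j)) = {}"
        using T unfolding V_def by auto
      then obtain i where "i < r" "x \<notin> T (k, i)"
        by auto
      then have "{j. j < r \<and> x \<in> T (k, j)} \<subseteq> {..<r} - {i}"
        by auto
      then have "card {j. j < r \<and> x \<in> T (k, j)} \<le> card ({..<r} - {i})"
        by (intro card_mono) auto
      then show "0 \<le> card {j. j < r \<and> x \<in> T (k, j)} \<and> card {j. j < r \<and> x \<in> T (k, j)} \<le> r - 1"
        using \<open>i < r\<close> by simp
    qed
    finally have "real (card (A T x)) \<le> real ((r - 1) ^ m)"
      by simp
    also have "\<dots> = p * real (card C)"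
      using assms(3) by (simp add: p cardC power_divide of_nat_diff)
    finally show ?thesis .
  qed
  have cardB: "real (card (B T)) * t powr (e * real (card X)) \<le> (?M * (1 + p * (t - 1))) ^ card X"
    if "T \<in> V" for T
    using chernoff_count[OF assms(1) finC assms(4), of "A T" p "e * real (card X)"] cardA[OF that]
    unfolding B_def by (auto simp: A_def cardC)
  have pos: "0 < t powr (e * real (card X))"
    using assms(4) by simp
  have p0: "0 \<le> p"
    using assms(3) by (simp add: p)
  have "real (card (\<Union>T\<in>V. B T)) * t powr (e * real (card X))
      \<le> (\<Sum>T\<in>V. real (card (B T))) * t powr (e * real (card X))"
  proof (rule mult_right_mono)
    show "real (card (\<Union>T\<in>V. B T)) \<le> (\<Sum>T\<in>V. real (card (B T)))"
      using card_UN_le[OF finV, of B] by (metis of_nat_le_iff of_nat_sum)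
  qed (use pos in simp)
  also have "\<dots> = (\<Sum>T\<in>V. real (card (B T)) * t powr (e * real (card X)))"
    by (simp add: sum_distrib_right)
  also have "\<dots> \<le> (\<Sum>T\<in>V. (?M * (1 + p * (t - 1))) ^ card X)"
    by (intro sum_mono cardB)
  also have "\<dots> \<le> real (card F ^ (m * r)) * (?M * (1 + p * (t - 1))) ^ card X"
    using cardV p0 assms(4) by (simp only: sum_constant, intro mult_right_mono) auto
  also have "\<dots> = ?M ^ card X * (real (card F ^ (m * r)) * (1 + p * (t - 1)) ^ card X)"
    by (simp add: power_mult_distrib)
  also have "\<dots> < ?M ^ card X * t powr (e * real (card X))"
    using small assms(3) by (intro mult_strict_left_mono) auto
  finally have "real (card (\<Union>T\<in>V. B T)) < ?M ^ card X"
    using pos by simp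
  moreover have "real (card (X \<rightarrow>\<^sub>E C)) = ?M ^ card X"
    using assms(1) by (simp add: card_PiE cardC)
  ultimately have "card (\<Union>T\<in>V. B T) < card (X \<rightarrow>\<^sub>E C)"
    by linarith
  moreover have "finite (\<Union>T\<in>V. B T)"
    using finV assms(1) finC unfolding B_def by (auto simp: finite_PiE)
  ultimately obtain f where f: "f \<in> X \<rightarrow>\<^sub>E C" "f \<notin> (\<Union>T\<in>V. B T)"
    by (meson card_mono not_le subsetI)
  show ?thesis
  proof (intro bexI[of _ f] allI impI)
    show "f \<in> X \<rightarrow>\<^sub>E ({1..m} \<rightarrow>\<^sub>E {..<r})"
      using f(1) unfolding C_def .
  next
    fix T
    assume "\<forall>k\<in>{1..m}. (\<forall>j<r. T k j \<in> F) \<and> (\<Inter>j<r. T k j) = {}"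
    then have T: "\<And>k j. k \<in> {1..m} \<Longrightarrow> j < r \<Longrightarrow> T k j \<in> F"
      "\<And>k. k \<in> {1..m} \<Longrightarrow> (\<Inter>j<r. T k j) = {}"
      by auto
    \<comment> \<open>Restricting to \<open>I\<close> turns an arbitrary system into an element of
      the finite set \<open>V\<close> over which the union bound ran.\<close>
    define T' where "T' = restrict (\<lambda>(k, j). T k j) I"
    have T'_eq: "T' (k, j) = T k j" if "k \<in> {1..m}" "j < r" for k j
      using that unfolding T'_def I_def by simp
    have "T' \<in> I \<rightarrow>\<^sub>E F"
      unfolding T'_def I_def using T(1) by auto
    moreover have "(\<Inter>j<r. T' (k, j)) = {}" if "k \<in> {1..m}" for k
      using T(2)[OF that] T'_eq[OF that] by simp
    ultimately have "T' \<in> V"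
      unfolding V_def by blast
    then have "real (card {x\<in>X. f x \<in> A T' x}) < e * real (card X)"
      using f unfolding B_def by auto
    moreover have "f x \<in> A T' x \<longleftrightarrow> (\<forall>k\<in>{1..m}. x \<in> T k (f x k))" if "x \<in> X" for x
    proof -
      have fx: "f x \<in> C"
        using f(1) that by auto
      then have "f x k < r" if "k \<in> {1..m}" for k
        using that unfolding C_def by auto
      then show ?thesis
        using fx T'_eq unfolding A_def by auto
    qed
    then have "{x\<in>X. f x \<in> A T' x} = {x\<in>X. \<forall>k\<in>{1..m}. x \<in> T k (f x k)}"
      by auto
    ultimately show "real (card {x\<in>X. \<forall>k\<in>{1..m}. x \<in> T k (f x k)}) < e * real (card X)"
      by simp
  qed
qed

section \<open>Sufficiency of the bound on \<epsilon>\<close>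

lemma tolerant_property_if:
  assumes r: "2 \<le> r" and e: "((real r - 1) / real r) ^ m < \<epsilon>"
  shows "tolerant_property TYPE('d::finite) \<epsilon> r m"
proof -
  define p where "p = ((real r - 1) / real r) ^ m"
  have p0: "0 \<le> p"
    using r by (simp add: p_def)
  obtain t where t: "1 < t" "1 + p * (t - 1) < t powr \<epsilon>"
    using chernoff_base e unfolding p_def by blast
  \<comment> \<open>Relative to all colourings, the bad ones for a single system make up at most
    \<open>\<rho> ^ n\<close> when \<open>n = card X\<close>. Since \<rho> < 1, this beats the
    polynomial number of systems of halfspace traces.\<close>
  define \<rho> where "\<rho> = (1 + p * (t - 1)) / t powr \<epsilon>"
  have "0 < 1 + p * (t - 1)"
    using p0 t(1) by (simp add: add_pos_nonneg)
  then have \<rho>: "0 < \<rho>" "\<rho> < 1"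
    using t unfolding \<rho>_def by (simp_all add: divide_simps)
  define D where "D = DIM(real ^ 'd)"
  define c where "c = real (D + 2)"
  have "c > 0"
    unfolding c_def by simp
  then have "(\<lambda>n. (c * (real n + 1) ^ (D + 1)) ^ (m * r) * \<rho> ^ n) \<longlonglongrightarrow> 0"
    using \<rho> by real_asymp
  then have "eventually (\<lambda>n. (c * (real n + 1) ^ (D + 1)) ^ (m * r) * \<rho> ^ n < 1) sequentially"
    by (rule order_tendstoD) simp
  then obtain N1 where N1: "\<And>n. N1 \<le> n \<Longrightarrow> (c * (real n + 1) ^ (D + 1)) ^ (m * r) * \<rho> ^ n < 1"
    unfolding eventually_sequentially by blast
  \<comment> \<open>The threshold is \<open>max N1 r\<close>: \<open>N1\<close> makes the union
    bound succeed, and \<open>r\<close> points are the least that allow \<open>r\<close> nonempty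
    parts, as used by \<open>g0\<close>.\<close>
  have "\<exists>P. (\<forall>k\<in>{1..m}. partition_into r X (P k)) \<and>
      (\<forall>Y\<subseteq>X. \<epsilon> * real (card X) \<le> real (card Y) \<longrightarrow>
        (\<exists>k\<in>{1..m}. Tverberg_partition r Y (restrict_partition (P k) Y)))"
    if X: "finite X" "max N1 r \<le> card X" for X :: "(real ^ 'd) set"
  proof -
    let ?n = "card X"
    define F where "F = (\<inter>) X ` (closed_halfspaces :: (real ^ 'd) set set)"
    have finF: "finite F"
      by (rule finite_subset[of _ "Pow X"]) (use X(1) in \<open>auto simp: F_def\<close>)
    have "card F \<le> (D + 2) * (?n + 1) ^ (D + 1)"
      using card_halfspace_traces_le[OF X(1)] unfolding F_def D_def .
    then have "real (card F) \<le> real ((D + 2) * (?n + 1) ^ (D + 1))"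
      by (rule of_nat_mono)
    then have "real (card F) \<le> c * (real ?n + 1) ^ (D + 1)"
      by (simp only: c_def of_nat_mult of_nat_power of_nat_add of_nat_1)
    then have "real (card F ^ (m * r)) * \<rho> ^ ?n \<le> (c * (real ?n + 1) ^ (D + 1)) ^ (m * r) * \<rho> ^ ?n"
      using \<rho>(1) by (simp only: of_nat_power, intro mult_right_mono power_mono) auto
    also have "\<dots> < 1"
      using N1 X(2) by simp
    finally have "real (card F ^ (m * r)) * (1 + p * (t - 1)) ^ ?n < (t powr \<epsilon>) ^ ?n"
      using t(1) unfolding \<rho>_def by (simp add: power_divide divide_simps)
    also have "(t powr \<epsilon>) ^ ?n = t powr (\<epsilon> * real ?n)"
      using t(1) by (simp add: powr_powr flip: powr_realpow)
    finally have small: "real (card F ^ (m * r)) * (1 + p * (t - 1)) ^ ?n < t powr (\<epsilon> * real ?n)" .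
    have "0 < r" "1 \<le> t"
      using r t(1) by simp_all
    from good_colouring_exists[OF X(1) finF this p_def small]
    obtain f where f: "f \<in> X \<rightarrow>\<^sub>E ({1..m} \<rightarrow>\<^sub>E {..<r})"
      "\<forall>T. (\<forall>k\<in>{1..m}. (\<forall>j<r. T k j \<in> F) \<and> (\<Inter>j<r. T k j) = {}) \<longrightarrow>
        real (card {x\<in>X. \<forall>k\<in>{1..m}. x \<in> T k (f x k)}) < \<epsilon> * real ?n"
      ..
    obtain h where h: "bij_betw h X {..<?n}"
      using ex_bij_betw_finite_nat[OF X(1)] by (auto simp: atLeast0LessThan)
    define g0 where "g0 x = h x mod r" for x
    have g0: "g0 ` X = {..<r}"
    proof
      show "g0 ` X \<subseteq> {..<r}"
        using r by (auto simp: g0_def)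
      show "{..<r} \<subseteq> g0 ` X"
      proof
        fix j assume j: "j \<in> {..<r}"
        then have "j \<in> h ` X"
          using h X(2) by (simp add: bij_betw_def)
        then obtain x where "x \<in> X" "h x = j"
          by auto
        then show "j \<in> g0 ` X"
          using j by (auto simp: g0_def intro!: rev_image_eqI)
      qed
    qed
    \<comment> \<open>A coordinate of \<open>f\<close> may miss a colour and then yields fewer than \<open>r\<close> parts; it never
      witnesses a Tverberg partition, so any surjective colouring may replace it.\<close>
    define g where "g k = (if (\<lambda>x. f x k) ` X = {..<r} then (\<lambda>x. f x k) else g0)" for k
    define P where "P k = fibres r (g k) X" for k
    have f_less: "f x k < r" if "x \<in> X" "k \<in> {1..m}" for x k
      using f(1) that by (auto simp: PiE_iff)
    have part: "partition_into r X (P k)" for k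
      unfolding P_def g_def using g0 by (auto intro!: partition_into_fibres)
    have "\<exists>k\<in>{1..m}. Tverberg_partition r Y (restrict_partition (P k) Y)"
      if Y: "Y \<subseteq> X" "\<epsilon> * real ?n \<le> real (card Y)" for Y
    proof (rule ccontr)
      assume no: "\<not> (\<exists>k\<in>{1..m}. Tverberg_partition r Y (restrict_partition (P k) Y))"
      have finY: "finite Y"
        using Y(1) X(1) finite_subset by blast
      define Z where "Z k j = convex hull {x\<in>Y. f x k = j}" for k j
      have "\<exists>H. (\<forall>j\<in>{..<r}. H j \<in> closed_halfspaces \<and> Z k j \<subseteq> H j) \<and> UNIV \<inter> (\<Inter>j\<in>{..<r}. H j) = {}"
        if k: "k \<in> {1..m}" for k
      proof (rule closed_halfspaces_empty_Inter)
        show "compact (Z k j) \<and> convex (Z k j)" for j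
          unfolding Z_def using finY by (simp add: finite_imp_compact_convex_hull)
        \<comment> \<open>A common point would make all \<open>r\<close> hulls nonempty. Coordinate
          \<open>k\<close> of \<open>f\<close> would then use every colour on \<open>Y\<close>,
          hence on \<open>X\<close>, so \<open>P k\<close> would consist of its fibres, and their
          restriction to \<open>Y\<close> would be a Tverberg partition, against
          \<open>no\<close>.\<close>
        show "UNIV \<inter> (\<Inter>j\<in>{..<r}. Z k j) = {}"
        proof (rule ccontr)
          assume ne: "UNIV \<inter> (\<Inter>j\<in>{..<r}. Z k j) \<noteq> {}"
          have "\<exists>x\<in>Y. f x k = j" if "j < r" for j
          proof (rule ccontr)
            assume "\<not> (\<exists>x\<in>Y. f x k = j)"
            then have "Z k j = {}"
              unfolding Z_def by simp
            then show False
              using ne that by blast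
          qed
          then have surj: "(\<lambda>x. f x k) ` Y = {..<r}" "(\<lambda>x. f x k) ` X = {..<r}"
            using f_less[OF _ k] Y(1) by fastforce+
          then have res: "restrict_partition (P k) Y = fibres r (\<lambda>x. f x k) Y"
            unfolding P_def g_def using Y(1) by (simp add: restrict_partition_fibres)
          have "Tverberg_partition r Y (restrict_partition (P k) Y)"
            unfolding res Tverberg_partition_def
            using finY partition_into_fibres[OF surj(1)] ne
            by (simp add: fibres_def Z_def)
          then show False
            using no k by blast
        qed
      qed auto
      then obtain H where "\<And>k. k \<in> {1..m} \<Longrightarrow>
          (\<forall>j\<in>{..<r}. H k j \<in> closed_halfspaces \<and> Z k j \<subseteq> H k j) \<and> UNIV \<inter> (\<Inter>j\<in>{..<r}. H k j) = {}"
        by metis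
      then have H: "\<And>k j. k \<in> {1..m} \<Longrightarrow> j < r \<Longrightarrow> H k j \<in> closed_halfspaces"
        "\<And>k j. k \<in> {1..m} \<Longrightarrow> j < r \<Longrightarrow> Z k j \<subseteq> H k j"
        "\<And>k. k \<in> {1..m} \<Longrightarrow> (\<Inter>j<r. H k j) = {}"
        by simp_all
      \<comment> \<open>The good colouring is tested against the traces of the separating halfspaces
        on \<open>X\<close>, whose intersections over \<open>j\<close> are still empty.\<close>
      have "real (card {x\<in>X. \<forall>k\<in>{1..m}. x \<in> X \<inter> H k (f x k)}) < \<epsilon> * real ?n"
      proof (rule f(2)[rule_format], intro ballI conjI allI impI)
        show "X \<inter> H k j \<in> F" if "k \<in> {1..m}" "j < r" for k j
          unfolding F_def using H(1)[OF that] by blast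
        show "(\<Inter>j<r. X \<inter> H k j) = {}" if "k \<in> {1..m}" for k
          using H(3)[OF that] r by auto
      qed
      \<comment> \<open>Each point of \<open>Y\<close> lies in the hull of its own colour class for
        every \<open>k\<close>, so all of \<open>Y\<close> is counted, which contradicts its
        size.\<close>
      moreover have "Y \<subseteq> {x\<in>X. \<forall>k\<in>{1..m}. x \<in> X \<inter> H k (f x k)}"
      proof
        fix x assume x: "x \<in> Y"
        have "x \<in> H k (f x k)" if k: "k \<in> {1..m}" for k
        proof -
          have "x \<in> Z k (f x k)"
            unfolding Z_def using x by (intro hull_inc) simp
          then show ?thesis
            using H(2)[OF k] f_less[OF _ k] x Y(1) by blast
        qed
        then show "x \<in> {x\<in>X. \<forall>k\<in>{1..m}. x \<in> X \<inter> H k (f x k)}"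
          using x Y(1) by auto
      qed
      then have "card Y \<le> card {x\<in>X. \<forall>k\<in>{1..m}. x \<in> X \<inter> H k (f x k)}"
        using X(1) by (intro card_mono) auto
      ultimately show False
        using Y(2) by linarith
    qed
    then show ?thesis
      using part by blast
  qed
  then show ?thesis
    unfolding tolerant_property_def by blast
qed

section \<open>Necessity by deleting parts\<close>

text \<open>Induction on \<open>m\<close>. The \<open>r\<close> parts of the next partition cut the
  current \<open>Y\<close> into pieces of average size \<open>card Y / r\<close>, so removing one of
  at most that size keeps a fraction \<open>(r - 1) / r\<close>. Parts emptied earlier stay empty
  when \<open>Y\<close> shrinks.\<close>

lemma exists_large_subset_missing_parts:
  assumes "finite X" "0 < r" "\<And>k. k \<in> {1..m} \<Longrightarrow> partition_into r X (P k)"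
  shows "\<exists>Y\<subseteq>X. ((real r - 1) / real r) ^ m * real (card X) \<le> real (card Y) \<and>
    (\<forall>k\<in>{1..m}. {} \<in> restrict_partition (P k) Y)"
  using assms(3)
proof (induction m)
  case 0
  show ?case by auto
next
  case (Suc m)
  define q where "q = (real r - 1) / real r"
  have q0: "0 \<le> q"
    using assms(2) by (simp add: q_def)
  obtain Y where Y: "Y \<subseteq> X" "q ^ m * real (card X) \<le> real (card Y)"
    "\<And>k. k \<in> {1..m} \<Longrightarrow> {} \<in> restrict_partition (P k) Y"
    using Suc unfolding q_def by auto
  have finY: "finite Y"
    using Y(1) assms(1) finite_subset by blast
  have P: "\<Union> (P (Suc m)) = X" "disjoint (P (Suc m))" "finite (P (Suc m))" "card (P (Suc m)) = r"
    using Suc.prems[of "Suc m"] by (auto simp: partition_into_def partition_on_def)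
  have "Y = (\<Union>K\<in>P (Suc m). K \<inter> Y)"
    using P(1) Y(1) by auto
  then have "card Y = card (\<Union>K\<in>P (Suc m). K \<inter> Y)"
    by simp
  also have "\<dots> = (\<Sum>K\<in>P (Suc m). card (K \<inter> Y))"
    using P(2,3) finY by (intro card_UN_disjoint) (auto simp: disjoint_def)
  finally have sum: "real (card Y) = (\<Sum>K\<in>P (Suc m). real (card (K \<inter> Y)))"
    by simp
  have "\<exists>K\<in>P (Suc m). real (card (K \<inter> Y)) \<le> real (card Y) / real r"
  proof (rule ccontr)
    assume "\<not> ?thesis"
    moreover have "P (Suc m) \<noteq> {}"
      using P(4) assms(2) by auto
    ultimately have "(\<Sum>K\<in>P (Suc m). real (card Y) / real r) < (\<Sum>K\<in>P (Suc m). real (card (K \<inter> Y)))"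
      using P(3) by (intro sum_strict_mono) auto
    then show False
      using sum P(4) assms(2) by simp
  qed
  then obtain K where K: "K \<in> P (Suc m)" "real (card (K \<inter> Y)) \<le> real (card Y) / real r"
    by blast
  have "real (card (Y - K)) = real (card Y) - real (card (K \<inter> Y))"
    using finY by (simp add: card_Diff_subset_Int Int_commute of_nat_diff card_mono)
  also have "\<dots> \<ge> q * real (card Y)"
    using K(2) assms(2) by (simp add: q_def field_simps)
  finally have "q * real (card Y) \<le> real (card (Y - K))" .
  moreover have "q ^ Suc m * real (card X) \<le> q * real (card Y)"
    using mult_left_mono[OF Y(2) q0] by (simp add: mult.assoc)
  ultimately have "q ^ Suc m * real (card X) \<le> real (card (Y - K))"
    by linarith
  moreover have "{} \<in> restrict_partition (P k) (Y - K)" if k: "k \<in> {1..Suc m}" for k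
  proof (cases "k = Suc m")
    case True
    then show ?thesis
      using K(1) unfolding restrict_partition_def by auto
  next
    case False
    then obtain L where "L \<in> P k" "L \<inter> Y = {}"
      using Y(3)[of k] k unfolding restrict_partition_def by fastforce
    then show ?thesis
      unfolding restrict_partition_def by auto
  qed
  ultimately show ?case
    using Y(1) unfolding q_def by (intro exI[of _ "Y - K"]) auto
qed

text \<open>The obstruction is combinatorial: a restriction that contains the empty set is not a
  partition, hence not a Tverberg partition. Any \<open>N0\<close> points serve as
  \<open>X\<close>.\<close>

lemma tolerant_property_only_if:
  assumes "0 < r" "tolerant_property TYPE('d::finite) \<epsilon> r m"
  shows "((real r - 1) / real r) ^ m < \<epsilon>"
proof (rule ccontr)
  assume "\<not> ?thesis"
  then have e: "\<epsilon> \<le> ((real r - 1) / real r) ^ m"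
    by simp
  obtain N0 where N0: "\<And>X :: (real ^ 'd) set. finite X \<and> N0 \<le> card X \<Longrightarrow>
        \<exists>P. (\<forall>k\<in>{1..m}. partition_into r X (P k)) \<and>
           (\<forall>Y\<subseteq>X. \<epsilon> * real (card X) \<le> real (card Y) \<longrightarrow>
              (\<exists>k\<in>{1..m}. Tverberg_partition r Y (restrict_partition (P k) Y)))"
    using assms(2) unfolding tolerant_property_def by blast
  obtain X :: "(real ^ 'd) set" where X: "finite X" "card X = N0"
    using infinite_arbitrarily_large[OF infinite_UNIV_char_0] by blast
  obtain P where P: "\<And>k. k \<in> {1..m} \<Longrightarrow> partition_into r X (P k)"
    "\<And>Y. Y \<subseteq> X \<Longrightarrow> \<epsilon> * real (card X) \<le> real (card Y) \<Longrightarrow>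
       \<exists>k\<in>{1..m}. Tverberg_partition r Y (restrict_partition (P k) Y)"
    using N0[of X] X by blast
  obtain Y where Y: "Y \<subseteq> X" "((real r - 1) / real r) ^ m * real (card X) \<le> real (card Y)"
    "\<And>k. k \<in> {1..m} \<Longrightarrow> {} \<in> restrict_partition (P k) Y"
    using exists_large_subset_missing_parts[OF X(1) assms(1), of m P] P(1) by metis
  have "\<epsilon> * real (card X) \<le> real (card Y)"
    using mult_right_mono[OF e, of "real (card X)"] Y(2) by linarith
  then obtain k where "k \<in> {1..m}" "Tverberg_partition r Y (restrict_partition (P k) Y)"
    using P(2)[OF Y(1)] by blast
  then show False
    using Y(3) unfolding Tverberg_partition_def partition_into_def partition_on_def by blast
qed

section \<open>The threshold in logarithmic form\<close>

theorem theorem1p3: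
  fixes \<epsilon> :: real and r :: nat
  assumes "0 < \<epsilon>" and "\<epsilon> \<le> 1" and "2 \<le> r"
  shows "(\<exists>m::nat. int m = \<lfloor>ln (1 / \<epsilon>) / ln (real r / (real r - 1))\<rfloor> + 1 \<and>
            0 < m \<and> tolerant_property TYPE('d::finite) \<epsilon> r m \<and>
            (\<forall>m'::nat. 0 < m' \<and> tolerant_property TYPE('d) \<epsilon> r m' \<longrightarrow> m \<le> m')) \<and>
         (\<forall>m::nat. 0 < m \<longrightarrow>
            (tolerant_property TYPE('d) \<epsilon> r m \<longleftrightarrow> \<epsilon> > ((real r - 1) / real r) ^ m))"
proof -
  have iff: "tolerant_property TYPE('d) \<epsilon> r m \<longleftrightarrow> ((real r - 1) / real r) ^ m < \<epsilon>" for m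
  proof
    show "((real r - 1) / real r) ^ m < \<epsilon>" if "tolerant_property TYPE('d) \<epsilon> r m"
      using assms(3) by (intro tolerant_property_only_if[OF _ that]) simp
    show "tolerant_property TYPE('d) \<epsilon> r m" if "((real r - 1) / real r) ^ m < \<epsilon>"
      using assms(3) that by (rule tolerant_property_if)
  qed
  define L where "L = ln (1 / \<epsilon>) / ln (real r / (real r - 1))"
  have base: "0 < ln (real r / (real r - 1))"
    using assms(3) by (intro ln_gt_zero) (simp add: field_simps)
  \<comment> \<open>From \<epsilon> \<le> 1 the quotient \<open>L\<close> is nonnegative, so its
    floor plus 1 is positive and survives the conversion to \<open>nat\<close>.\<close>
  have L0: "0 \<le> L"
    unfolding L_def using base assms by (intro divide_nonneg_pos ln_ge_zero) simp_all
  \<comment> \<open>Taking logarithms turns the condition into \<open>L < real m\<close>. The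
    inequality is strict, so an integer value of \<open>L\<close> is itself excluded, which is why
    the threshold is floor plus 1 and not the ceiling.\<close>
  have less: "((real r - 1) / real r) ^ m < \<epsilon> \<longleftrightarrow> \<lfloor>L\<rfloor> + 1 \<le> int m" for m
  proof -
    have "((real r - 1) / real r) ^ m < \<epsilon> \<longleftrightarrow> ln (((real r - 1) / real r) ^ m) < ln \<epsilon>"
      using assms by (intro ln_less_cancel_iff[symmetric]) auto
    also have "ln (((real r - 1) / real r) ^ m) = - real m * ln (real r / (real r - 1))"
      using assms(3) by (simp add: ln_realpow ln_div algebra_simps)
    also have "- real m * ln (real r / (real r - 1)) < ln \<epsilon>
        \<longleftrightarrow> ln (1 / \<epsilon>) < real m * ln (real r / (real r - 1))"
      using assms(1) by (auto simp: ln_div)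
    also have "\<dots> \<longleftrightarrow> L < real m"
      unfolding L_def using base by (simp add: pos_divide_less_eq)
    also have "\<dots> \<longleftrightarrow> \<lfloor>L\<rfloor> + 1 \<le> int m"
      by linarith
    finally show ?thesis .
  qed
  have "int (nat (\<lfloor>L\<rfloor> + 1)) = \<lfloor>L\<rfloor> + 1"
    using L0 by simp
  then show ?thesis
    unfolding iff less unfolding L_def[symmetric] using L0
    by (intro conjI exI[of _ "nat (\<lfloor>L\<rfloor> + 1)"]) auto
qed

end
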